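(* For every odd integer $n\ge5$ there exists a $2$-complex $A=A_n$ on $n$ vertices, with full $1$-skeleton and exactly $\binom{n-1}{2}-(n+1)$ $2$-faces, which is $2$-collapsible and remains $2$-collapsible after the addition of any $2$-face not in it. In particular, the set of $2$-faces of $A$ is acyclic and has empty shadow over every field.
   Context: A $(d-1)$-face of a $d$-complex is exposed if it lies in exactly one $d$-face; an elementary collapse removes an exposed $(d-1)$-face and the unique $d$-face containing it; a $d$-complex is $d$-collapsible if all its $d$-faces can be removed by a sequence of elementary collapses. Over a field $\mathbb{F}$, a set $S$ of $2$-faces is acyclic if the columns of the boundary matrix $\partial_2$ (with $\partial(v_0,v_1,v_2)=(v_1,v_2)-(v_0,v_2)+(v_0,v_1)$) indexed by $S$ are linearly independent; the shadow of $S$ is the set of $2$-faces $\sigma\notin S$ whose column lies in the $\mathbb{F}$-span of the columns of $S$. *)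

theory Defs
  imports Complex_Main "HOL-Library.Function_Algebras"
begin

text \<open>
  A complex is its set of nonempty faces, each face being its set of vertices.
  A \<open>d\<close>-complex has dimension at most \<open>d\<close>: it may have no \<open>d\<close>-faces at all.
\<close>

definition simplicial_complex_on :: "'a set \<Rightarrow> 'a set set \<Rightarrow> bool" where
  "simplicial_complex_on V K \<longleftrightarrow>
     (\<forall>\<sigma>\<in>K. \<sigma> \<noteq> {} \<and> finite \<sigma> \<and> \<sigma> \<subseteq> V) \<and>
     (\<forall>v\<in>V. {v} \<in> K) \<and>
     (\<forall>\<sigma>\<in>K. \<forall>\<tau>. \<tau> \<subseteq> \<sigma> \<longrightarrow> \<tau> \<noteq> {} \<longrightarrow> \<tau> \<in> K)"

definition faces :: "nat \<Rightarrow> 'a set set \<Rightarrow> 'a set set" where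
  "faces k K = {\<sigma> \<in> K. card \<sigma> = k + 1}"

definition complex_of_dim_on :: "nat \<Rightarrow> 'a set \<Rightarrow> 'a set set \<Rightarrow> bool" where
  "complex_of_dim_on d V K \<longleftrightarrow> simplicial_complex_on V K \<and> (\<forall>\<sigma>\<in>K. card \<sigma> \<le> d + 1)"

definition all_faces :: "nat \<Rightarrow> 'a set \<Rightarrow> 'a set set" where
  "all_faces k V = {\<sigma>. \<sigma> \<subseteq> V \<and> finite \<sigma> \<and> card \<sigma> = k + 1}"

definition full_skeleton :: "nat \<Rightarrow> 'a set \<Rightarrow> 'a set set \<Rightarrow> bool" where
  "full_skeleton k V K \<longleftrightarrow> (\<forall>j\<le>k. all_faces j V \<subseteq> K)"

text \<open>Collapses; these are meant for \<open>d \<ge> 1\<close>.\<close>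

definition exposed :: "nat \<Rightarrow> 'a set set \<Rightarrow> 'a set \<Rightarrow> bool" where
  "exposed d K \<tau> \<longleftrightarrow> \<tau> \<in> faces (d - 1) K \<and> (\<exists>!\<sigma>. \<sigma> \<in> faces d K \<and> \<tau> \<subseteq> \<sigma>)"

definition elementary_collapse :: "nat \<Rightarrow> 'a set set \<Rightarrow> 'a set set \<Rightarrow> bool" where
  "elementary_collapse d K K' \<longleftrightarrow>
     (\<exists>\<tau> \<sigma>. exposed d K \<tau> \<and> \<sigma> \<in> faces d K \<and> \<tau> \<subseteq> \<sigma> \<and> K' = K - {\<tau>, \<sigma>})"

definition collapsible :: "nat \<Rightarrow> 'a set set \<Rightarrow> bool" where
  "collapsible d K \<longleftrightarrow> (\<exists>K'. (elementary_collapse d)\<^sup>*\<^sup>* K K' \<and> faces d K' = {})"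

text \<open>
  The column of \<open>\<partial>\<^sub>2\<close> at a 2-face, as a function of the row index (an edge).
  Edges and 2-faces are oriented by increasing order of their vertices.
\<close>

definition boundary2 :: "'v::linorder set \<Rightarrow> 'v set \<Rightarrow> 'f::field" where
  "boundary2 \<sigma> = (case sorted_list_of_set \<sigma> of
      [v0, v1, v2] \<Rightarrow>
        (\<lambda>e. of_bool (e = {v1, v2}) - of_bool (e = {v0, v2}) + of_bool (e = {v0, v1}))
    | _ \<Rightarrow> (\<lambda>e. 0))"

definition fun_scale :: "'f::field \<Rightarrow> ('e \<Rightarrow> 'f) \<Rightarrow> 'e \<Rightarrow> 'f" where
  "fun_scale c v = (\<lambda>e. c * v e)"

global_interpretation fun_space: vector_space "fun_scale :: 'f::field \<Rightarrow> ('e \<Rightarrow> 'f) \<Rightarrow> 'e \<Rightarrow> 'f"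
  by unfold_locales (auto simp: fun_scale_def algebra_simps)

text \<open>
  Independence is that of the family of columns indexed by \<open>S\<close>, hence the injectivity condition.
  The first argument only carries the coefficient field.
\<close>

definition acyclic_over :: "'f::field itself \<Rightarrow> 'v::linorder set set \<Rightarrow> bool" where
  "acyclic_over _ S \<longleftrightarrow>
     inj_on (boundary2 :: 'v set \<Rightarrow> 'v set \<Rightarrow> 'f) S \<and>
     fun_space.independent ((boundary2 :: 'v set \<Rightarrow> 'v set \<Rightarrow> 'f) ` S)"

definition shadow_over :: "'f::field itself \<Rightarrow> 'v::linorder set \<Rightarrow> 'v set set \<Rightarrow> 'v set set" where
  "shadow_over _ V S =
     {\<sigma> \<in> all_faces 2 V - S.
        (boundary2 \<sigma> :: 'v set \<Rightarrow> 'f) \<in> fun_space.span (boundary2 ` S)}"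

end

theory Submission
  imports Defs
begin

text \<open>
  Write \<open>n = 2 m + 1\<close> and place the vertices on the cycle of integers modulo \<open>n\<close>. Every edge is
  \<open>{y - j, y}\<close> for a unique \<open>y\<close> and a unique length \<open>1 \<le> j \<le> m\<close>. The 2-faces of \<open>A\<close> are the
  \<open>n (m - 2)\<close> triangles \<open>{y - k, y - k + 1, y}\<close> with \<open>3 \<le> k \<le> m\<close>; an edge \<open>{y - j, y}\<close> of length
  \<open>j \<ge> 2\<close> lies in at most two of them, the ones with the same apex \<open>y\<close> and \<open>k = j\<close> or \<open>k = j + 1\<close>.
  So \<open>A\<close> collapses by decreasing \<open>k\<close>.
  A further triangle \<open>\<sigma>\<close> always has a vertex \<open>y\<close> such that exactly one edge of \<open>\<sigma>\<close> has the form
  \<open>{y - i, y}\<close> with \<open>2 \<le> i \<le> m\<close>. In the fan with apex \<open>y\<close> one first removes the triangles with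
  \<open>k > i\<close> from the top, then those with \<open>k \<le> i\<close> from the bottom (through \<open>{y - 2, y}\<close>), which frees
  the edge \<open>{y - i, y}\<close> of \<open>\<sigma>\<close>.
  Collapsibility implies acyclicity because the column of a collapsed face is the only one with a
  nonzero entry in the row of the exposed edge.
\<close>

section \<open>Collapses\<close>

text \<open>Collapsing greedily cannot get stuck when every nonempty family of
  \<open>d\<close>-faces has a member with a free facet. This condition passes to subfamilies, which
  carries the induction on the number of \<open>d\<close>-faces.\<close>

lemma collapsible_if_free_faces:
  assumes "finite (faces d K)" and "d \<ge> 1"
    and "\<And>\<rho> \<tau>. \<rho> \<in> faces d K \<Longrightarrow> \<tau> \<subseteq> \<rho> \<Longrightarrow> card \<tau> = d \<Longrightarrow> \<tau> \<in> K"
    and "\<And>S. S \<subseteq> faces d K \<Longrightarrow> S \<noteq> {} \<Longrightarrow>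
           \<exists>\<sigma>\<in>S. \<exists>\<tau>. \<tau> \<subseteq> \<sigma> \<and> card \<tau> = d \<and> (\<forall>\<rho>\<in>S. \<tau> \<subseteq> \<rho> \<longrightarrow> \<rho> = \<sigma>)"
  shows "collapsible d K"
  using assms
proof (induction "card (faces d K)" arbitrary: K)
  case 0
  then have "faces d K = {}" by simp
  then show ?case unfolding collapsible_def by blast
next
  case (Suc c)
  then have "faces d K \<noteq> {}" by auto
  then obtain \<sigma> \<tau> where \<sigma>: "\<sigma> \<in> faces d K" and \<tau>: "\<tau> \<subseteq> \<sigma>" "card \<tau> = d"
    and free: "\<And>\<rho>. \<rho> \<in> faces d K \<Longrightarrow> \<tau> \<subseteq> \<rho> \<Longrightarrow> \<rho> = \<sigma>"
    using Suc.prems(4)[of "faces d K"] by blast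
  have "\<tau> \<in> K" using Suc.prems(3) \<sigma> \<tau> by blast
  then have "\<tau> \<in> faces (d - 1) K" using \<tau> \<open>d \<ge> 1\<close> by (simp add: faces_def)
  then have "exposed d K \<tau>"
    using \<sigma> \<tau> free unfolding exposed_def by blast
  then have step: "elementary_collapse d K (K - {\<tau>, \<sigma>})"
    using \<sigma> \<tau> unfolding elementary_collapse_def by blast
  have faces': "faces d (K - {\<tau>, \<sigma>}) = faces d K - {\<sigma>}"
    using \<tau> by (auto simp: faces_def)
  have "collapsible d (K - {\<tau>, \<sigma>})"
  proof (rule Suc.hyps(1))
    show "c = card (faces d (K - {\<tau>, \<sigma>}))"
      using Suc.hyps(2) Suc.prems(1) \<sigma> by (simp add: faces')
    show "finite (faces d (K - {\<tau>, \<sigma>}))" using Suc.prems(1) by (simp add: faces')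
    show "d \<ge> 1" by fact
    \<comment> \<open>By freeness \<sigma> was the only \<open>d\<close>-face containing \<tau>, so
      no remaining \<open>d\<close>-face loses a facet; and \<sigma> itself is too large to be a
      facet.\<close>
    show "\<tau>' \<in> K - {\<tau>, \<sigma>}"
      if "\<rho> \<in> faces d (K - {\<tau>, \<sigma>})" "\<tau>' \<subseteq> \<rho>" "card \<tau>' = d" for \<rho> \<tau>'
      using that Suc.prems(3)[of \<rho> \<tau>'] free[of \<rho>] \<sigma> by (auto simp: faces' faces_def)
    show "\<exists>\<sigma>\<in>S. \<exists>\<tau>. \<tau> \<subseteq> \<sigma> \<and> card \<tau> = d \<and> (\<forall>\<rho>\<in>S. \<tau> \<subseteq> \<rho> \<longrightarrow> \<rho> = \<sigma>)"
      if "S \<subseteq> faces d (K - {\<tau>, \<sigma>})" "S \<noteq> {}" for S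
      using that by (intro Suc.prems(4)) (auto simp: faces')
  qed
  then show ?case
    using step unfolding collapsible_def by (meson converse_rtranclp_into_rtranclp)
qed

section \<open>Linear independence of boundary columns\<close>

lemma sorted_triangle:
  fixes \<sigma> :: "'a::linorder set"
  assumes "card \<sigma> = 3"
  obtains a b c where "sorted_list_of_set \<sigma> = [a, b, c]" "\<sigma> = {a, b, c}" "a < b" "b < c"
proof -
  have fin: "finite \<sigma>" using assms card.infinite by fastforce
  have "length (sorted_list_of_set \<sigma>) = Suc (Suc (Suc 0))" using assms by simp
  then obtain a b c where l: "sorted_list_of_set \<sigma> = [a, b, c]"
    unfolding length_Suc_conv by auto
  moreover have "\<sigma> = {a, b, c}" using fin set_sorted_list_of_set[of \<sigma>] l by simp
  moreover have "a < b" "b < c" using strict_sorted_list_of_set[of \<sigma>] by (auto simp: l)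
  ultimately show thesis using that by blast
qed

lemma boundary2_eq_zero:
  assumes "card \<sigma> = 3" and "\<not> \<tau> \<subseteq> \<sigma>"
  shows "boundary2 \<sigma> \<tau> = (0 :: 'f::field)"
proof -
  obtain a b c where "sorted_list_of_set \<sigma> = [a, b, c]" "\<sigma> = {a, b, c}"
    using sorted_triangle[OF assms(1)] by metis
  then show ?thesis using assms(2) by (auto simp: boundary2_def)
qed

lemma boundary2_neq_zero:
  assumes "card \<sigma> = 3" and "\<tau> \<subseteq> \<sigma>" and "card \<tau> = 2"
  shows "boundary2 \<sigma> \<tau> \<noteq> (0 :: 'f::field)"
proof -
  obtain a b c where l: "sorted_list_of_set \<sigma> = [a, b, c]" and \<sigma>: "\<sigma> = {a, b, c}"
    and dist: "a < b" "b < c"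
    using sorted_triangle[OF assms(1)] by metis
  obtain u v where "\<tau> = {u, v}" "u \<noteq> v" using assms(3) by (auto simp: card_2_iff)
  then consider "\<tau> = {b, c}" | "\<tau> = {a, c}" | "\<tau> = {a, b}"
    using assms(2) \<sigma> by auto
  then show ?thesis
    using dist by cases (auto simp: boundary2_def l doubleton_eq_iff)
qed

lemma acyclic_over_elementary_collapse:
  assumes "elementary_collapse 2 K K'" and "acyclic_over TYPE('f::field) (faces 2 K')"
  shows "acyclic_over TYPE('f) (faces 2 K)"
proof -
  let ?b = "boundary2 :: 'a set \<Rightarrow> 'a set \<Rightarrow> 'f"
  obtain \<tau> \<sigma> where ex: "exposed 2 K \<tau>" and \<sigma>: "\<sigma> \<in> faces 2 K" "\<tau> \<subseteq> \<sigma>" and K': "K' = K - {\<tau>, \<sigma>}"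
    using assms(1) unfolding elementary_collapse_def by blast
  have \<tau>: "card \<tau> = 2" and free: "\<And>\<rho>. \<rho> \<in> faces 2 K \<Longrightarrow> \<tau> \<subseteq> \<rho> \<Longrightarrow> \<rho> = \<sigma>"
    using ex \<sigma> unfolding exposed_def by (auto simp: faces_def)
  have ins: "faces 2 K = insert \<sigma> (faces 2 K')" and notin: "\<sigma> \<notin> faces 2 K'"
    using \<sigma> \<tau> by (auto simp: K' faces_def)
  \<comment> \<open>The functions vanishing in row \<tau> form a subspace that contains every column
    left after the collapse, but not the column of \<sigma>.\<close>
  have "fun_space.subspace {v :: 'a set \<Rightarrow> 'f. v \<tau> = 0}"
    by (auto simp: fun_space.subspace_def fun_scale_def)
  moreover have "?b ` faces 2 K' \<subseteq> {v. v \<tau> = 0}"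
    using free notin ins by (auto simp: faces_def intro!: boundary2_eq_zero)
  ultimately have "fun_space.span (?b ` faces 2 K') \<subseteq> {v. v \<tau> = 0}"
    by (intro fun_space.span_minimal)
  moreover have "?b \<sigma> \<tau> \<noteq> 0"
    using \<sigma> \<tau> by (intro boundary2_neq_zero) (auto simp: faces_def)
  ultimately have "?b \<sigma> \<notin> fun_space.span (?b ` faces 2 K')" by auto
  moreover from this have "?b \<sigma> \<notin> ?b ` faces 2 K'"
    using fun_space.span_base by blast
  ultimately show ?thesis
    using assms(2) notin
    by (auto simp: acyclic_over_def ins fun_space.independent_insert)
qed

lemma acyclic_over_if_collapsible:
  assumes "collapsible 2 K"
  shows "acyclic_over TYPE('f::field) (faces 2 K)"
proof -
  obtain L where "(elementary_collapse 2)\<^sup>*\<^sup>* K L" and L: "faces 2 L = {}"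
    using assms unfolding collapsible_def by blast
  then show ?thesis
  proof (induction rule: converse_rtranclp_induct)
    case base
    show ?case by (simp add: L acyclic_over_def fun_space.independent_empty)
  next
    case (step K K')
    then show ?case using acyclic_over_elementary_collapse by blast
  qed
qed

text \<open>A face in the shadow would make the columns dependent once it is added, contradicting
  collapsibility of the enlarged complex.\<close>

lemma shadow_over_empty:
  assumes "collapsible 2 A"
    and "\<forall>\<sigma> \<in> all_faces 2 V - A. collapsible 2 (insert \<sigma> A)"
  shows "shadow_over TYPE('f::field) V (faces 2 A) = {}"
proof -
  let ?b = "boundary2 :: 'a set \<Rightarrow> 'a set \<Rightarrow> 'f"
  have "?b \<sigma> \<notin> fun_space.span (?b ` faces 2 A)" if "\<sigma> \<in> all_faces 2 V - faces 2 A" for \<sigma>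
  proof -
    have "\<sigma> \<in> all_faces 2 V - A" and ins: "faces 2 (insert \<sigma> A) = insert \<sigma> (faces 2 A)"
      using that by (auto simp: all_faces_def faces_def)
    then have "acyclic_over TYPE('f) (insert \<sigma> (faces 2 A))"
      using assms(2) acyclic_over_if_collapsible[of "insert \<sigma> A"] by fastforce
    then show ?thesis
      using that by (auto simp: acyclic_over_def fun_space.independent_insert)
  qed
  then show ?thesis by (auto simp: shadow_over_def)
qed

section \<open>The fan complex\<close>

text \<open>\<open>behind m y j\<close> is \<open>y - j\<close> modulo \<open>2 m + 1\<close>, for \<open>j \<le> 2 m + 1\<close>.\<close>

definition behind :: "nat \<Rightarrow> nat \<Rightarrow> nat \<Rightarrow> nat" where
  "behind m y j = (if j \<le> y then y - j else y + (2 * m + 1) - j)"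

definition chord :: "nat \<Rightarrow> nat \<Rightarrow> nat \<Rightarrow> nat set" where
  "chord m y j = {behind m y j, y}"

definition fan_face :: "nat \<Rightarrow> nat \<Rightarrow> nat \<Rightarrow> nat set" where
  "fan_face m y k = {behind m y k, behind m y (k - 1), y}"

definition fan_faces :: "nat \<Rightarrow> nat set set" where
  "fan_faces m = {fan_face m y k | y k. y < 2 * m + 1 \<and> 3 \<le> k \<and> k \<le> m}"

definition fan_complex :: "nat \<Rightarrow> nat set set" where
  "fan_complex m = {\<sigma>. \<sigma> \<noteq> {} \<and> \<sigma> \<subseteq> {..<2 * m + 1} \<and> card \<sigma> \<le> 2} \<union> fan_faces m"

lemma behind_eq_iff:
  "y < 2 * m + 1 \<Longrightarrow> i < 2 * m + 1 \<Longrightarrow> j < 2 * m + 1 \<Longrightarrow> behind m y i = behind m y j \<longleftrightarrow> i = j"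
  by (auto simp: behind_def)

lemma behind_0 [simp]: "behind m y 0 = y"
  by (simp add: behind_def)

lemma behind_add:
  "y < 2 * m + 1 \<Longrightarrow> i + j < 2 * m + 1 \<Longrightarrow> behind m (behind m y i) j = behind m y (i + j)"
  by (simp add: behind_def)

lemma card_chord: "y < 2 * m + 1 \<Longrightarrow> 1 \<le> j \<Longrightarrow> j \<le> m \<Longrightarrow> card (chord m y j) = 2"
  by (auto simp: chord_def behind_def card_insert_if)

lemma card_fan_face: "y < 2 * m + 1 \<Longrightarrow> 3 \<le> k \<Longrightarrow> k \<le> m \<Longrightarrow> card (fan_face m y k) = 3"
  by (auto simp: fan_face_def behind_def card_insert_if)

lemma fan_face_subset: "y < 2 * m + 1 \<Longrightarrow> 3 \<le> k \<Longrightarrow> k \<le> m \<Longrightarrow> fan_face m y k \<subseteq> {..<2 * m + 1}"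
  by (auto simp: fan_face_def behind_def)

lemma chord_subset_fan_face:
  assumes "3 \<le> k"
  shows "chord m y k \<subseteq> fan_face m y k" and "chord m y (k - 1) \<subseteq> fan_face m y k"
  by (auto simp: chord_def fan_face_def)

text \<open>A fan triangle has sides of lengths \<open>k\<close> and \<open>k - 1\<close> ending at
  its apex, and a third side of length 1, too short for \<open>j \<ge> 2\<close>. The bounds by
  \<open>m\<close> exclude reading a side backwards, since its length would then become at least
  \<open>m + 1\<close>.\<close>

lemma chord_subset_fan_faceD:
  assumes "chord m y j \<subseteq> fan_face m y' k"
    and "y < 2 * m + 1" "2 \<le> j" "j \<le> m" "y' < 2 * m + 1" "3 \<le> k" "k \<le> m"
  shows "y' = y \<and> (k = j \<or> k = j + 1)"
proof -
  have "behind m y j = behind m y' k \<or> behind m y j = behind m y' (k - 1) \<or> behind m y j = y'"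
    and "y = behind m y' k \<or> y = behind m y' (k - 1) \<or> y = y'"
    using assms(1) by (auto simp: chord_def fan_face_def)
  then show ?thesis
    using assms(2-) unfolding behind_def by (auto split: if_splits)
qed

text \<open>The longest side of each triangle lies in the other, so \<open>k'\<close> is
  \<open>k\<close> or \<open>k + 1\<close> while \<open>k\<close> is \<open>k'\<close> or
  \<open>k' + 1\<close>.\<close>

lemma fan_face_inject:
  assumes "fan_face m y k = fan_face m y' k'"
    and "y < 2 * m + 1" "3 \<le> k" "k \<le> m" "y' < 2 * m + 1" "3 \<le> k'" "k' \<le> m"
  shows "y = y' \<and> k = k'"
proof -
  have "chord m y k \<subseteq> fan_face m y' k'" "chord m y' k' \<subseteq> fan_face m y k"
    using assms chord_subset_fan_face(1) by metis+
  then show ?thesis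
    using chord_subset_fan_faceD[of m y k y' k'] chord_subset_fan_faceD[of m y' k' y k] assms(2-)
    by auto
qed

lemma fan_faces_eq_image:
  "fan_faces m = (\<lambda>(y, k). fan_face m y k) ` ({..<2 * m + 1} \<times> {3..m})"
  by (force simp: fan_faces_def image_iff)

lemma card_fan_faces: "card (fan_faces m) = (2 * m + 1) * (m - 2)"
proof -
  have "inj_on (\<lambda>(y, k). fan_face m y k) ({..<2 * m + 1} \<times> {3..m})"
    using fan_face_inject by (force simp: inj_on_def)
  then show ?thesis
    by (simp add: fan_faces_eq_image card_image card_cartesian_product)
qed

lemma faces_fan_complex: "faces 2 (fan_complex m) = fan_faces m"
  by (auto simp: faces_def fan_complex_def fan_faces_def card_fan_face)

lemma complex_fan_complex: "complex_of_dim_on 2 {..<2 * m + 1} (fan_complex m)"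
proof -
  have *: "\<sigma> \<noteq> {} \<and> finite \<sigma> \<and> \<sigma> \<subseteq> {..<2 * m + 1} \<and> card \<sigma> \<le> 3" if "\<sigma> \<in> fan_complex m" for \<sigma>
  proof (cases "\<sigma> \<in> fan_faces m")
    case True
    then have "card \<sigma> = 3" "\<sigma> \<subseteq> {..<2 * m + 1}"
      using card_fan_face fan_face_subset unfolding fan_faces_def by blast+
    then show ?thesis using card.infinite by fastforce
  next
    case False
    then show ?thesis using that by (auto simp: fan_complex_def intro: finite_subset)
  qed
  have vertex: "{v} \<in> fan_complex m" if "v \<in> {..<2 * m + 1}" for v
    using that by (simp add: fan_complex_def)
  have "\<tau> \<in> fan_complex m" if "\<sigma> \<in> fan_complex m" "\<tau> \<subseteq> \<sigma>" "\<tau> \<noteq> {}" for \<sigma> \<tau>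
  proof (cases "\<tau> = \<sigma>")
    case False
    then have "card \<tau> < card \<sigma>" using that *[of \<sigma>] by (auto intro: psubset_card_mono)
    then have "card \<tau> \<le> 2" "\<tau> \<subseteq> {..<2 * m + 1}" using that(1,2) *[of \<sigma>] by auto
    then show ?thesis using that(3) by (simp add: fan_complex_def)
  qed (use that in simp)
  moreover have "card \<sigma> \<le> 2 + 1" if "\<sigma> \<in> fan_complex m" for \<sigma>
    using *[OF that] by simp
  ultimately show ?thesis
    unfolding complex_of_dim_on_def simplicial_complex_on_def
    using * vertex by blast
qed

lemma full_skeleton_fan_complex: "full_skeleton 1 {..<2 * m + 1} (fan_complex m)"
  by (auto simp: full_skeleton_def all_faces_def fan_complex_def)

section \<open>Free edges among fan triangles, with and without an extra face\<close>

lemma fan_faces_free_edge: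
  assumes "S \<subseteq> fan_faces m" and "S \<noteq> {}"
  shows "\<exists>\<sigma>\<in>S. \<exists>\<tau>. \<tau> \<subseteq> \<sigma> \<and> card \<tau> = 2 \<and> (\<forall>\<rho>\<in>S. \<tau> \<subseteq> \<rho> \<longrightarrow> \<rho> = \<sigma>)"
proof -
  \<comment> \<open>The indices are taken over all apices. For the largest one, the side of length
    \<open>Max J\<close> could be shared only with the triangle of index \<open>Max J + 1\<close> at
    the same apex, which is not in \<open>S\<close>.\<close>
  define J where "J = {k. \<exists>y < 2 * m + 1. 3 \<le> k \<and> k \<le> m \<and> fan_face m y k \<in> S}"
  have "finite J" by (rule finite_subset[of _ "{..m}"]) (auto simp: J_def)
  moreover have "J \<noteq> {}" using assms by (fastforce simp: J_def fan_faces_def)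
  ultimately have "Max J \<in> J" and max: "\<And>k. k \<in> J \<Longrightarrow> k \<le> Max J" by auto
  then obtain y where y: "y < 2 * m + 1" "3 \<le> Max J" "Max J \<le> m" "fan_face m y (Max J) \<in> S"
    by (auto simp: J_def)
  have "\<rho> = fan_face m y (Max J)" if \<rho>: "\<rho> \<in> S" "chord m y (Max J) \<subseteq> \<rho>" for \<rho>
  proof -
    obtain y' k where k: "\<rho> = fan_face m y' k" "y' < 2 * m + 1" "3 \<le> k" "k \<le> m"
      using \<rho> assms(1) unfolding fan_faces_def by blast
    then have "k \<in> J" using \<rho> unfolding J_def by blast
    then have "k \<le> Max J" by (rule max)
    then show ?thesis using chord_subset_fan_faceD[of m y "Max J" y' k] k \<rho> y by auto
  qed
  moreover have "chord m y (Max J) \<subseteq> fan_face m y (Max J)" "card (chord m y (Max J)) = 2"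
    using y by (simp_all add: chord_subset_fan_face card_chord)
  ultimately show ?thesis using y(4) by blast
qed

lemma insert_fan_faces_free_edge:
  assumes S: "S \<subseteq> insert \<sigma> (fan_faces m)" "S \<noteq> {}"
    and y: "y < 2 * m + 1" and i: "2 \<le> i" "i \<le> m" "chord m y i \<subseteq> \<sigma>"
    and uniq: "\<And>j. 2 \<le> j \<Longrightarrow> j \<le> m \<Longrightarrow> chord m y j \<subseteq> \<sigma> \<Longrightarrow> j = i"
  shows "\<exists>\<rho>\<in>S. \<exists>\<tau>. \<tau> \<subseteq> \<rho> \<and> card \<tau> = 2 \<and> (\<forall>\<rho>'\<in>S. \<tau> \<subseteq> \<rho>' \<longrightarrow> \<rho>' = \<rho>)"
proof -
  \<comment> \<open>Here only the fan with the fixed apex \<open>y\<close> matters.\<close>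
  define J where "J = {k. 3 \<le> k \<and> k \<le> m \<and> fan_face m y k \<in> S}"
  have fin: "finite J" by (rule finite_subset[of _ "{..m}"]) (auto simp: J_def)
  have cont: "\<rho> = \<sigma> \<and> j = i \<or> (\<exists>k. \<rho> = fan_face m y k \<and> k \<in> J \<and> (k = j \<or> k = j + 1))"
    if j: "\<rho> \<in> S" "chord m y j \<subseteq> \<rho>" "2 \<le> j" "j \<le> m" for \<rho> j
  proof (cases "\<rho> = \<sigma>")
    case True
    then show ?thesis using uniq j by auto
  next
    case False
    then obtain y' k where k: "\<rho> = fan_face m y' k" "y' < 2 * m + 1" "3 \<le> k" "k \<le> m"
      using j S unfolding fan_faces_def by blast
    then show ?thesis using chord_subset_fan_faceD[of m y j y' k] j y by (auto simp: J_def)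
  qed
  \<comment> \<open>The cases follow the order of collapses in that fan. For \<open>top\<close>, the
    longest chord of the fan exceeds \<open>i\<close>, so it avoids \<sigma>. For
    \<open>bottom\<close>, the chord of length \<open>Min J - 1\<close> is shorter than
    \<open>i\<close>, so it also avoids \<sigma>; its length is at least 2 because fan indices start
    at 3. Once the fan is gone, \<open>chord m y i\<close> is free in \<sigma>.\<close>
  consider (top) k where "k \<in> J" "k > i" | (bottom) "J \<noteq> {}" "\<forall>k\<in>J. k \<le> i"
    | (extra) "J = {}" "\<sigma> \<in> S" | (fans) "\<sigma> \<notin> S"
    by fastforce
  then show ?thesis
  proof cases
    case (top k)
    define l where "l = Max J"
    have l: "l \<in> J" "i < l" "\<And>k. k \<in> J \<Longrightarrow> k \<le> l"
      using top fin Max_in[of J] Max_ge[of J] less_le_trans unfolding l_def by blast+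
    then have l': "3 \<le> l" "l \<le> m" "fan_face m y l \<in> S" by (auto simp: J_def)
    have "\<rho> = fan_face m y l" if "\<rho> \<in> S" "chord m y l \<subseteq> \<rho>" for \<rho>
      using cont[OF that] l l' by fastforce
    moreover have "chord m y l \<subseteq> fan_face m y l" "card (chord m y l) = 2"
      using l' y by (simp_all add: chord_subset_fan_face card_chord)
    ultimately show ?thesis using l'(3) by blast
  next
    case bottom
    define l where "l = Min J"
    have l: "l \<in> J" "l \<le> i" "\<And>k. k \<in> J \<Longrightarrow> l \<le> k"
      using bottom fin Min_in[of J] Min_le[of J] unfolding l_def by blast+
    then have l': "3 \<le> l" "l \<le> m" "fan_face m y l \<in> S" by (auto simp: J_def)
    have "\<rho> = fan_face m y l" if "\<rho> \<in> S" "chord m y (l - 1) \<subseteq> \<rho>" for \<rho>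
      using cont[OF that] l l' by fastforce
    moreover have "chord m y (l - 1) \<subseteq> fan_face m y l"
      by (rule chord_subset_fan_face(2)[OF l'(1)])
    moreover have "card (chord m y (l - 1)) = 2"
      using l' by (intro card_chord[OF y]) auto
    ultimately show ?thesis using l'(3) by blast
  next
    case extra
    then have "\<rho> = \<sigma>" if "\<rho> \<in> S" "chord m y i \<subseteq> \<rho>" for \<rho>
      using cont[OF that] i by blast
    then show ?thesis using extra(2) i(3) card_chord[OF y, of i] i(1,2) by (meson one_le_numeral le_trans)
  next
    case fans
    then show ?thesis using fan_faces_free_edge[of S m] S by blast
  qed
qed

section \<open>Triangles outside the fans\<close>

lemma oriented_triangle_unique_chord:
  assumes "x < 2 * m + 1" "y < 2 * m + 1" "z < 2 * m + 1" "m \<ge> 2"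
    and pos: "a \<ge> 1" "b \<ge> 1" and sum: "a + b + c = 2 * m + 1" and max: "a \<le> c" "b \<le> c"
    and gaps: "behind m y a = x" "behind m z b = y" "behind m x c = z"
    and notfan: "{x, y, z} \<notin> fan_faces m"
  shows "\<exists>w i. w < 2 * m + 1 \<and> 2 \<le> i \<and> i \<le> m \<and> chord m w i \<subseteq> {x, y, z} \<and>
           (\<forall>j. 2 \<le> j \<longrightarrow> j \<le> m \<longrightarrow> chord m w j \<subseteq> {x, y, z} \<longrightarrow> j = i)"
proof -
  \<comment> \<open>Together with \<open>gaps\<close>, this gives for each vertex the backward
    distances of the other two: one gap, and the sum of two consecutive gaps.\<close>
  have zx: "behind m z (a + b) = x" and yz: "behind m y (a + c) = z" and xy: "behind m x (b + c) = y"
    using behind_add[of z m b a] behind_add[of y m a c] behind_add[of x m c b]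
      assms(1-3) pos sum max gaps by (simp_all add: add.commute)
  \<comment> \<open>The apex is \<open>x\<close>, \<open>y\<close>, \<open>z\<close> in the first
    three cases. From \<open>x\<close> the distances are \<open>c\<close> and
    \<open>b + c > m\<close>; from \<open>y\<close> they are \<open>a\<close> and
    \<open>a + c > m\<close>; from \<open>z\<close> they are 1 and 2. In the last case
    \<open>z\<close> sees both \<open>b\<close> and \<open>b + 1\<close> within \<open>m\<close>,
    which makes the triangle a fan triangle.\<close>
  consider "c \<le> m" | "a \<ge> 2" "c > m" | "a = 1" "b = 1" "c > m" | "a = 1" "b \<ge> 2" "c > m"
    using pos by linarith
  then show ?thesis
  proof cases
    case 1
    have "j = c" if "2 \<le> j" "j \<le> m" "chord m x j \<subseteq> {x, y, z}" for j
    proof -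
      have "behind m x j = behind m x 0 \<or> behind m x j = behind m x c \<or> behind m x j = behind m x (b + c)"
        using that(3) gaps(3) xy by (auto simp: chord_def)
      moreover have "j < 2 * m + 1" "c < 2 * m + 1" "b + c < 2 * m + 1"
        using that(2) pos sum max by linarith+
      ultimately have "j = 0 \<or> j = c \<or> j = b + c"
        using assms(1-3) behind_eq_iff by (metis zero_less_Suc Suc_eq_plus1)
      then show ?thesis using that(1,2) pos sum max 1 by linarith
    qed
    moreover have "chord m x c \<subseteq> {x, y, z}" using gaps(3) by (simp add: chord_def)
    \<comment> \<open>The largest of three gaps summing to \<open>2 * m + 1 \<ge> 5\<close> is at
      least 2.\<close>
    moreover have "2 \<le> c" using sum max \<open>m \<ge> 2\<close> by linarith
    ultimately show ?thesis
      using assms(1,4) 1 by blast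
  next
    case 2
    have "j = a" if "2 \<le> j" "j \<le> m" "chord m y j \<subseteq> {x, y, z}" for j
    proof -
      have "behind m y j = behind m y 0 \<or> behind m y j = behind m y a \<or> behind m y j = behind m y (a + c)"
        using that(3) gaps(1) yz by (auto simp: chord_def)
      moreover have "j < 2 * m + 1" "a < 2 * m + 1" "a + c < 2 * m + 1"
        using that(2) pos sum max by linarith+
      ultimately have "j = 0 \<or> j = a \<or> j = a + c"
        using assms(1-3) behind_eq_iff by (metis zero_less_Suc Suc_eq_plus1)
      then show ?thesis using that(1,2) pos sum max 2 by linarith
    qed
    moreover have "chord m y a \<subseteq> {x, y, z}" using gaps(1) by (simp add: chord_def)
    moreover have "a \<le> m" using sum 2 by linarith
    ultimately show ?thesis
      using assms(2,4) 2 by blast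
  next
    case 3
    have "j = 2" if "2 \<le> j" "j \<le> m" "chord m z j \<subseteq> {x, y, z}" for j
    proof -
      have "behind m z j = behind m z 0 \<or> behind m z j = behind m z b \<or> behind m z j = behind m z (a + b)"
        using that(3) gaps(2) zx by (auto simp: chord_def)
      moreover have "j < 2 * m + 1" "b < 2 * m + 1" "a + b < 2 * m + 1"
        using that(2) pos sum max by linarith+
      ultimately have "j = 0 \<or> j = b \<or> j = a + b"
        using assms(1-3) behind_eq_iff by (metis zero_less_Suc Suc_eq_plus1)
      then show ?thesis using that(1,2) pos sum max 3 by linarith
    qed
    moreover have "chord m z 2 \<subseteq> {x, y, z}" using zx 3 by (simp add: chord_def numeral_2_eq_2)
    ultimately show ?thesis
      using assms(3,4) by blast
  next
    case 4
    then have "{x, y, z} = fan_face m z (a + b)"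
      using gaps zx by (auto simp: fan_face_def)
    moreover have "3 \<le> a + b" "a + b \<le> m" using 4 sum by linarith+
    ultimately show ?thesis using notfan assms(3) unfolding fan_faces_def by blast
  qed
qed

lemma triangle_unique_chord:
  assumes "\<sigma> \<subseteq> {..<2 * m + 1}" "card \<sigma> = 3" "\<sigma> \<notin> fan_faces m" "m \<ge> 2"
  obtains y i where "y < 2 * m + 1" "2 \<le> i" "i \<le> m" "chord m y i \<subseteq> \<sigma>"
    "\<And>j. 2 \<le> j \<Longrightarrow> j \<le> m \<Longrightarrow> chord m y j \<subseteq> \<sigma> \<Longrightarrow> j = i"
proof -
  obtain u v w where \<sigma>: "\<sigma> = {u, v, w}" and uv: "u < v" and vw: "v < w"
    using sorted_triangle[OF assms(2)] by metis
  have lt: "u < 2 * m + 1" "v < 2 * m + 1" "w < 2 * m + 1" using assms(1) \<sigma> by auto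
  define a b c where "a = v - u" and "b = w - v" and "c = u + (2 * m + 1) - w"
  note defs = this
  have gaps: "behind m v a = u" "behind m w b = v" "behind m u c = w"
    and pos: "a \<ge> 1" "b \<ge> 1" "c \<ge> 1" and sum: "a + b + c = 2 * m + 1"
    using uv vw lt by (auto simp: behind_def defs)
  have rot: "\<sigma> = {v, w, u}" "\<sigma> = {w, u, v}" using \<sigma> by auto
  \<comment> \<open>Rotating the cyclic order of the vertices puts the largest gap last, as the
    preceding lemma requires.\<close>
  consider "a \<le> c" "b \<le> c" | "b \<le> a" "c \<le> a" | "c \<le> b" "a \<le> b" by linarith
  then have "\<exists>y i. y < 2 * m + 1 \<and> 2 \<le> i \<and> i \<le> m \<and> chord m y i \<subseteq> \<sigma> \<and>
           (\<forall>j. 2 \<le> j \<longrightarrow> j \<le> m \<longrightarrow> chord m y j \<subseteq> \<sigma> \<longrightarrow> j = i)"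
  proof cases
    case 1
    then show ?thesis
      using oriented_triangle_unique_chord[of u m v w a b c] lt assms(3,4) pos sum gaps
      unfolding \<sigma> by blast
  next
    case 2
    then show ?thesis
      using oriented_triangle_unique_chord[of v m w u b c a] lt assms(3,4) pos sum gaps
      unfolding rot(1) by simp
  next
    case 3
    then show ?thesis
      using oriented_triangle_unique_chord[of w m u v c a b] lt assms(3,4) pos sum gaps
      unfolding rot(2) by simp
  qed
  then show thesis using that by blast
qed

section \<open>Collapsibility of the fan complex and the final count\<close>

lemma collapsible_fan_complex: "collapsible 2 (fan_complex m)"
proof (rule collapsible_if_free_faces)
  show "finite (faces 2 (fan_complex m))"
    by (simp add: faces_fan_complex fan_faces_eq_image)
  show "\<tau> \<in> fan_complex m" if "\<rho> \<in> faces 2 (fan_complex m)" "\<tau> \<subseteq> \<rho>" "card \<tau> = 2" for \<rho> \<tau>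
  proof -
    have "\<rho> \<in> fan_complex m" "\<tau> \<noteq> {}" using that by (auto simp: faces_def)
    then show ?thesis
      using that(2) complex_fan_complex[of m]
      unfolding complex_of_dim_on_def simplicial_complex_on_def by blast
  qed
qed (auto simp: faces_fan_complex fan_faces_free_edge)

lemma collapsible_insert_fan_complex:
  assumes "m \<ge> 2" and \<sigma>: "\<sigma> \<in> all_faces 2 {..<2 * m + 1} - fan_complex m"
  shows "collapsible 2 (insert \<sigma> (fan_complex m))"
proof -
  have \<sigma>': "\<sigma> \<subseteq> {..<2 * m + 1}" "card \<sigma> = 3" "\<sigma> \<notin> fan_faces m"
    using \<sigma> by (auto simp: all_faces_def fan_complex_def)
  then obtain y i where yi: "y < 2 * m + 1" "2 \<le> i" "i \<le> m" "chord m y i \<subseteq> \<sigma>"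
    "\<And>j. 2 \<le> j \<Longrightarrow> j \<le> m \<Longrightarrow> chord m y j \<subseteq> \<sigma> \<Longrightarrow> j = i"
    using triangle_unique_chord \<open>m \<ge> 2\<close> by metis
  have faces: "faces 2 (insert \<sigma> (fan_complex m)) = insert \<sigma> (fan_faces m)"
    using faces_fan_complex[of m] \<sigma>' by (auto simp: faces_def)
  have edge: "\<tau> \<in> fan_complex m" if "\<rho> \<subseteq> {..<2 * m + 1}" "\<tau> \<subseteq> \<rho>" "card \<tau> = 2" for \<rho> \<tau>
    using that by (auto simp: fan_complex_def)
  show ?thesis
  proof (rule collapsible_if_free_faces)
    show "finite (faces 2 (insert \<sigma> (fan_complex m)))"
      by (simp add: faces fan_faces_eq_image)
    show "\<tau> \<in> insert \<sigma> (fan_complex m)"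
      if "\<rho> \<in> faces 2 (insert \<sigma> (fan_complex m))" "\<tau> \<subseteq> \<rho>" "card \<tau> = 2" for \<rho> \<tau>
      using that edge[of \<rho> \<tau>] \<sigma>'(1) fan_face_subset unfolding faces by (auto simp: fan_faces_def)
  qed (auto simp: faces intro!: insert_fan_faces_free_edge[OF _ _ yi])
qed

theorem theorem7:
  fixes n :: nat
  assumes "odd n" and "n \<ge> 5"
  shows
    "(\<exists>A :: nat set set.
        complex_of_dim_on 2 {..<n} A \<and> full_skeleton 1 {..<n} A \<and>
        card (faces 2 A) = ((n - 1) choose 2) - (n + 1) \<and>
        collapsible 2 A \<and>
        (\<forall>\<sigma> \<in> all_faces 2 {..<n} - A. collapsible 2 (insert \<sigma> A))) \<and>
     (\<forall>A :: nat set set.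
        complex_of_dim_on 2 {..<n} A \<and> full_skeleton 1 {..<n} A \<and>
        card (faces 2 A) = ((n - 1) choose 2) - (n + 1) \<and>
        collapsible 2 A \<and>
        (\<forall>\<sigma> \<in> all_faces 2 {..<n} - A. collapsible 2 (insert \<sigma> A)) \<longrightarrow>
        acyclic_over TYPE('f::field) (faces 2 A) \<and>
        shadow_over TYPE('f) {..<n} (faces 2 A) = {})"
proof (rule conjI)
  obtain m where n: "n = 2 * m + 1" using \<open>odd n\<close> by (rule oddE)
  with \<open>n \<ge> 5\<close> have "m \<ge> 2" by simp
  \<comment> \<open>This turns the truncated difference \<open>m - 2\<close> into \<open>p\<close>.
    The identity below is stated with \<open>n + 1\<close> added, so it also shows that the
    subtraction in the face count is exact.\<close>
  then obtain p where m: "m = p + 2" using le_Suc_ex by (metis add.commute)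
  have "(n - 1) choose 2 = m * (2 * m - 1)"
    by (simp add: n choose_two)
  also have "\<dots> = (2 * m + 1) * (m - 2) + (n + 1)"
    by (simp add: m n algebra_simps)
  finally have "card (faces 2 (fan_complex m)) = ((n - 1) choose 2) - (n + 1)"
    by (simp add: faces_fan_complex card_fan_faces)
  then show "\<exists>A :: nat set set.
        complex_of_dim_on 2 {..<n} A \<and> full_skeleton 1 {..<n} A \<and>
        card (faces 2 A) = ((n - 1) choose 2) - (n + 1) \<and>
        collapsible 2 A \<and>
        (\<forall>\<sigma> \<in> all_faces 2 {..<n} - A. collapsible 2 (insert \<sigma> A))"
    using complex_fan_complex full_skeleton_fan_complex collapsible_fan_complex
      collapsible_insert_fan_complex[OF \<open>m \<ge> 2\<close>] unfolding n by blast
qed (use acyclic_over_if_collapsible shadow_over_empty in blast)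

end
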